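(* The tree $T(3,3,3)$ has $n=21$ vertices and satisfies \[ \pi(T(3,3,3)) = 2\left(\frac32\right)^{(21-3)/2}=2\left(\frac32\right)^{9}, \] but $T(3,3,3)$ is not isomorphic to $S(21,10)$.
   Context: All graphs are finite and simple. For a graph $G$, $d(v)$ denotes the degree of a vertex $v$, and $L(G)=D(G)-A(G)$ is the Laplacian matrix, where $A(G)$ is the adjacency matrix and $D(G)$ is the diagonal matrix of degrees. The permanent of an $n\times n$ matrix $M=(m_{ij})$ is $\operatorname{per}(M)=\sum_{\sigma\in S_n}\prod_{i=1}^n m_{i,\sigma(i)}$. If $G$ has no isolated vertices, its Laplacian ratio is $\pi(G)=\operatorname{per}(L(G))/\prod_{v\in V(G)}d(v)$. For $m\ge 2$ and nonnegative integers $a_1,\ldots,a_m$, the tree $T(a_1,\ldots,a_m)$ is obtained from the path $x_1-x_2-\cdots-x_m$ by attaching, for each $i$, exactly $a_i$ pendant paths of length two to the vertex $x_i$; that is, each attached path has the form $x_i-y-z$ with new vertices $y,z$, where $y$ is adjacent exactly to $x_i$ and $z$, and $z$ is a leaf. For odd $n$, $S(n,(n-1)/2)$ is the subdivided star on $n$ vertices obtained from the star on $(n+1)/2$ vertices by attaching one pendant edge to each noncentral vertex. In particular, $S(21,10)$ is obtained from the star on $11$ vertices (a center with $10$ leaves) by attaching one pendant edge to each of the $10$ noncentral vertices. *)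

theory Defs
  imports
    Complex_Main
    "HOL-Combinatorics.Permutations"
    "Graph_Theory.Graph_Theory"
begin

text \<open>
  Finite simple graphs are the library's \<^locale>\<open>pair_graph\<close>s: finite loop-free symmetric
  digraphs without parallel arcs, so every edge is present as an arc in both directions.
  For such a graph, \<^const>\<open>out_degree\<close> is the degree, and \<^const>\<open>digraph_iso\<close> is
  graph isomorphism (lemma \<open>digraph_iso_pair_iff\<close> below).
\<close>

definition edge_graph :: "'a set \<Rightarrow> ('a \<times> 'a) set \<Rightarrow> 'a pair_pre_digraph" where
  "edge_graph V E = \<lparr> pverts = V, parcs = E \<union> E\<inverse> \<rparr>"

definition degree :: "'a pair_pre_digraph \<Rightarrow> 'a \<Rightarrow> nat" where
  "degree G v = out_degree (with_proj G) v"

text \<open>Square matrices are indexed by the vertices themselves rather than by \<open>1, \<dots>, n\<close>.\<close>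

definition adjacency_matrix :: "'a pair_pre_digraph \<Rightarrow> 'a \<Rightarrow> 'a \<Rightarrow> real" where
  "adjacency_matrix G u v = (if (u, v) \<in> parcs G then 1 else 0)"

definition degree_matrix :: "'a pair_pre_digraph \<Rightarrow> 'a \<Rightarrow> 'a \<Rightarrow> real" where
  "degree_matrix G u v = (if u = v then real (degree G u) else 0)"

definition laplacian :: "'a pair_pre_digraph \<Rightarrow> 'a \<Rightarrow> 'a \<Rightarrow> real" where
  "laplacian G u v = degree_matrix G u v - adjacency_matrix G u v"

definition permanent :: "'a set \<Rightarrow> ('a \<Rightarrow> 'a \<Rightarrow> real) \<Rightarrow> real" where
  "permanent I M = (\<Sum>\<sigma> | \<sigma> permutes I. \<Prod>i\<in>I. M i (\<sigma> i))"

text \<open>Meaningful only for graphs without isolated vertices (otherwise the quotient is \<open>0\<close>).\<close>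

definition laplacian_ratio :: "'a pair_pre_digraph \<Rightarrow> real" where
  "laplacian_ratio G = permanent (pverts G) (laplacian G) / (\<Prod>v\<in>pverts G. real (degree G v))"

text \<open>
  The tree \<open>T(a\<^sub>1, \<dots>, a\<^sub>m)\<close> for the list \<open>as = [a\<^sub>1, \<dots>, a\<^sub>m]\<close>, \<open>m \<ge> 2\<close>. Indices start at \<open>0\<close>:
  \<open>Spine i\<close> is \<open>x\<^sub>i\<^sub>+\<^sub>1\<close>, and its \<open>j\<close>-th pendant path is \<open>Spine i - Inner i j - Outer i j\<close>.
\<close>

datatype tree_vertex = Spine nat | Inner nat nat | Outer nat nat

definition T :: "nat list \<Rightarrow> tree_vertex pair_pre_digraph" where
  "T as = edge_graph
     ({Spine i | i. i < length as}
       \<union> {Inner i j | i j. i < length as \<and> j < as ! i}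
       \<union> {Outer i j | i j. i < length as \<and> j < as ! i})
     ({(Spine i, Spine (Suc i)) | i. Suc i < length as}
       \<union> {(Spine i, Inner i j) | i j. i < length as \<and> j < as ! i}
       \<union> {(Inner i j, Outer i j) | i j. i < length as \<and> j < as ! i})"

text \<open>
  \<open>subdivided_star n\<close> is \<open>S(n, (n - 1) / 2)\<close>, for odd \<open>n\<close>: the star with centre \<open>Center\<close> and
  leaves \<open>Mid j\<close>, \<open>j < (n - 1) / 2\<close>, with one pendant edge \<open>Mid j - Tip j\<close> at each leaf.
\<close>

datatype star_vertex = Center | Mid nat | Tip nat

definition subdivided_star :: "nat \<Rightarrow> star_vertex pair_pre_digraph" where
  "subdivided_star n = edge_graph
     ({Center} \<union> {Mid j | j. j < (n - 1) div 2} \<union> {Tip j | j. j < (n - 1) div 2})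
     ({(Center, Mid j) | j. j < (n - 1) div 2} \<union> {(Mid j, Tip j) | j. j < (n - 1) div 2})"

lemma pair_graph_edge_graph:
  assumes "finite V" "E \<subseteq> V \<times> V" "\<And>u. (u, u) \<notin> E"
  shows "pair_graph (edge_graph V E)"
proof -
  have "finite E"
    using assms(1,2) by (meson finite_SigmaI finite_subset)
  moreover have "sym (E \<union> E\<inverse>)"
    by (auto simp: sym_def)
  ultimately show ?thesis
    using assms by unfold_locales (auto simp: edge_graph_def symmetric_def)
qed

lemma pair_graph_T: "pair_graph (T as)"
proof -
  have "{Inner i j | i j. i < length as \<and> j < as ! i} = (\<Union>i<length as. Inner i ` {..<as ! i})"
       "{Outer i j | i j. i < length as \<and> j < as ! i} = (\<Union>i<length as. Outer i ` {..<as ! i})"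
    by auto
  then show ?thesis
    unfolding T_def by (intro pair_graph_edge_graph) auto
qed

lemma pair_graph_subdivided_star: "pair_graph (subdivided_star n)"
  unfolding subdivided_star_def by (intro pair_graph_edge_graph) auto

lemma degree_eq_card_neighbours: "degree G v = card {w. (v, w) \<in> parcs G}"
proof -
  have "out_arcs (with_proj G) v = Pair v ` {w. (v, w) \<in> parcs G}"
    by (auto simp: out_arcs_def)
  then show ?thesis
    by (simp add: degree_def out_degree_def card_image inj_on_def)
qed

lemma degree_T_pos:
  assumes "length as \<ge> 2" "v \<in> pverts (T as)"
  shows "degree (T as) v > 0"
proof -
  interpret pair_graph "T as" by (rule pair_graph_T)
  have "{w. (v, w) \<in> parcs (T as)} \<subseteq> pverts (T as)"
    using in_arcsD2 by blast
  then have fin: "finite {w. (v, w) \<in> parcs (T as)}"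
    using pair_finite_verts finite_subset by blast
  have "\<exists>w. (v, w) \<in> parcs (T as)"
  proof (cases v)
    case (Spine i)
    show ?thesis
    proof (cases i)
      case 0
      then have "(v, Spine 1) \<in> parcs (T as)"
        using assms Spine by (auto simp: T_def edge_graph_def)
      then show ?thesis ..
    next
      case (Suc k)
      then have "(v, Spine k) \<in> parcs (T as)"
        using assms Spine by (auto simp: T_def edge_graph_def)
      then show ?thesis ..
    qed
  qed (use assms in \<open>auto simp: T_def edge_graph_def\<close>)
  with fin show ?thesis
    by (auto simp: degree_eq_card_neighbours card_gt_0_iff)
qed

lemma digraph_iso_pair_iff:
  assumes "pair_wf_digraph G" "pair_wf_digraph H"
  shows "digraph_iso (with_proj G) (with_proj H) \<longleftrightarrow>
    (\<exists>f. bij_betw f (pverts G) (pverts H) \<and>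
         (\<forall>u\<in>pverts G. \<forall>v\<in>pverts G. (u, v) \<in> parcs G \<longleftrightarrow> (f u, f v) \<in> parcs H))"
    (is "_ \<longleftrightarrow> (\<exists>f. ?bij f \<and> ?pres f)")
proof
  interpret G: pair_wf_digraph G by fact
  assume "digraph_iso (with_proj G) (with_proj H)"
  then obtain h where h: "pre_digraph.digraph_isomorphism (with_proj G) h"
    and H: "with_proj H = app_iso h (with_proj G)"
    by (auto simp: digraph_iso_def)
  let ?f = "iso_verts h"
  from H have ht: "iso_tail h = fst" "iso_head h = snd"
    and V: "pverts H = ?f ` pverts G" and A: "parcs H = iso_arcs h ` parcs G"
    by (simp_all add: app_iso_def with_proj_def)
  from h have inj: "inj_on ?f (pverts G)"
    by (auto simp: pre_digraph.digraph_isomorphism_def)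
  have arc: "iso_arcs h e = (?f (fst e), ?f (snd e))" if "e \<in> parcs G" for e
    using h that ht by (auto simp: pre_digraph.digraph_isomorphism_def prod_eq_iff)
  have "?bij ?f"
    using inj V by (simp add: bij_betw_def)
  moreover have "?pres ?f"
  proof (intro ballI iffI)
    fix u v assume "(u, v) \<in> parcs G"
    then show "(?f u, ?f v) \<in> parcs H"
      using A arc by force
  next
    fix u v assume uv: "u \<in> pverts G" "v \<in> pverts G" and "(?f u, ?f v) \<in> parcs H"
    then obtain e where e: "e \<in> parcs G" "(?f u, ?f v) = (?f (fst e), ?f (snd e))"
      using A arc by force
    then have "fst e = u" "snd e = v"
      using uv inj G.arc_fst_in_verts G.arc_snd_in_verts by (auto dest: inj_onD)
    then show "(u, v) \<in> parcs G"
      using e by (metis prod.collapse)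
  qed
  ultimately show "\<exists>f. ?bij f \<and> ?pres f"
    by blast
next
  interpret G: pair_wf_digraph G by fact
  interpret H: pair_wf_digraph H by fact
  assume "\<exists>f. ?bij f \<and> ?pres f"
  then obtain f where inj: "inj_on f (pverts G)" and V: "pverts H = f ` pverts G"
    and pres: "?pres f"
    by (auto simp: bij_betw_def)
  define h where "h = \<lparr> iso_verts = f, iso_arcs = map_prod f f, iso_head = snd, iso_tail = fst \<rparr>"
  have A: "parcs H = map_prod f f ` parcs G"
  proof (intro equalityI subsetI)
    fix e assume e: "e \<in> parcs H"
    then obtain u v where "u \<in> pverts G" "v \<in> pverts G" "e = (f u, f v)"
      using V H.arc_fst_in_verts H.arc_snd_in_verts by (metis imageE prod.collapse)
    then show "e \<in> map_prod f f ` parcs G"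
      using e pres by force
  next
    fix e assume "e \<in> map_prod f f ` parcs G"
    then obtain u v where "(u, v) \<in> parcs G" "e = (f u, f v)"
      by auto
    then show "e \<in> parcs H"
      using pres G.in_arcsD1[of u v] G.in_arcsD2[of u v] by blast
  qed
  have "inj_on (map_prod f f) (pverts G \<times> pverts G)"
    using inj by (rule map_prod_inj_on[OF _ inj])
  moreover have "parcs G \<subseteq> pverts G \<times> pverts G"
    using G.in_arcsD1 G.in_arcsD2 by auto
  ultimately have "inj_on (map_prod f f) (parcs G)"
    by (rule inj_on_subset)
  then have "pre_digraph.digraph_isomorphism (with_proj G) h"
    unfolding pre_digraph.digraph_isomorphism_def using inj G.wf_digraph
    by (simp add: h_def)
  moreover have "with_proj H = app_iso h (with_proj G)"
    using V A by (simp add: app_iso_def with_proj_def h_def)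
  ultimately show "digraph_iso (with_proj G) (with_proj H)"
    unfolding digraph_iso_def by blast
qed

end

theory Submission
  imports Defs
begin

text \<open>
  The permanent of the Laplacian of a tree can be computed by eliminating leaves, as a determinant
  is computed by Schur complements. If \<open>z\<close> is a leaf with neighbour \<open>y\<close> in the support of \<open>M\<close>, a
  permutation contributing to \<open>per M\<close> either fixes \<open>z\<close> or swaps \<open>z\<close> and \<open>y\<close>; both kinds are accounted
  for by deleting \<open>z\<close>, extracting the factor \<open>M z z\<close>, and adding \<open>M z y * M y z / M z z\<close> to the diagonal
  entry at \<open>y\<close> (\<open>permanent_insert_leaf\<close>).

  In a pendant path \<open>x - y - z\<close> the vertex \<open>z\<close> has diagonal entry \<open>1\<close>; eliminating it raises the entry
  of \<open>y\<close> from \<open>2\<close> to \<open>3\<close>, and eliminating \<open>y\<close> then adds \<open>1 / 3\<close> to the entry of \<open>x\<close>. So every pendant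
  path yields a factor \<open>3\<close> and a diagonal increment \<open>1 / 3\<close> at its foot (\<open>permanent_laplacian_T\<close>).
  For \<open>T(3,3,3)\<close> the nine paths give \<open>3 ^ 9\<close> and leave the spine matrix with diagonal
  \<open>4 + 1, 5 + 1, 4 + 1\<close> and entries \<open>-1\<close> next to it, whose permanent is \<open>150 + 5 + 5 = 160\<close>.
  The degrees multiply to \<open>4 * 5 * 4 * 2 ^ 9 = 80 * 2 ^ 9\<close>, so the ratio is \<open>2 * (3 / 2) ^ 9\<close>.

  The two trees are told apart by their degrees: the centre of \<open>S(21,10)\<close> has degree \<open>10\<close>, while no
  vertex of \<open>T(3,3,3)\<close> has degree above \<open>5\<close>.
\<close>

section \<open>Permanents and leaf elimination\<close>

lemma permanent_cong:
  assumes "\<And>u v. u \<in> I \<Longrightarrow> v \<in> I \<Longrightarrow> M u v = N u v"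
  shows "permanent I M = permanent I N"
  unfolding permanent_def using assms
  by (intro sum.cong prod.cong) (auto simp: permutes_in_image)

lemma permanent_singleton: "permanent {x} M = M x x"
proof -
  have "{\<sigma>. \<sigma> permutes {x}} = {id}"
    by auto
  then show ?thesis
    by (simp add: permanent_def)
qed

definition add_diagonal :: "('a \<Rightarrow> 'a \<Rightarrow> real) \<Rightarrow> ('a \<Rightarrow> real) \<Rightarrow> 'a \<Rightarrow> 'a \<Rightarrow> real" where
  "add_diagonal M c u v = M u v + (if u = v then c u else 0)"

text \<open>
  Write each permutation of \<open>insert z I\<close> as \<open>transpose z b \<circ> q\<close> with \<open>q\<close> permuting \<open>I\<close>, so that \<open>b\<close> is the
  image of \<open>z\<close>. Only \<open>b = z\<close> and \<open>b = y\<close> can contribute, and the two terms belonging to the same \<open>q\<close>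
  add up to \<open>M z z\<close> times the term of \<open>q\<close> in the corrected matrix: if \<open>q\<close> moves \<open>y\<close>, the term for
  \<open>b = y\<close> vanishes and the corrected entry does not occur, and if \<open>q\<close> fixes \<open>y\<close>, the term for \<open>b = y\<close>
  is the one produced by the correction.
\<close>

lemma permanent_insert_leaf:
  assumes fin: "finite I" and z: "z \<notin> I" and y: "y \<in> I" and nz: "M z z \<noteq> 0"
    and leaf: "\<And>v. v \<in> I \<Longrightarrow> v \<noteq> y \<Longrightarrow> M z v = 0 \<and> M v z = 0"
  shows "permanent (insert z I) M
    = M z z * permanent I (add_diagonal M ((\<lambda>_. 0)(y := M z y * M y z / M z z)))"
proof -
  let ?c = "M z y * M y z / M z z"
  let ?N = "add_diagonal M ((\<lambda>_. 0)(y := ?c))"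
  let ?term = "\<lambda>b q. \<Prod>i\<in>insert z I. M i ((transpose z b \<circ> q) i)"
  have split: "?term b q = M z b * (\<Prod>i\<in>I. M i (transpose z b (q i)))"
    if "q permutes I" for b q
    using that fin z by (simp add: permutes_not_in)
  have other: "?term b q = 0" if "q permutes I" "b \<in> I - {y}" for b q
    using that leaf by (simp only: split) auto
  have "?term z q + ?term y q = M z z * (\<Prod>i\<in>I. ?N i (q i))" if q: "q permutes I" for q
  proof (cases "q y = y")
    case True
    have q': "q i \<noteq> y \<and> q i \<noteq> z" if "i \<in> I - {y}" for i
      using that True q z by (metis DiffE insertCI permutes_in_image permutes_inj_on permutes_inverses(2) that)
    have "?term y q = M z y * (M y z * (\<Prod>i\<in>I - {y}. M i (q i)))"
    proof -
      have "(\<Prod>i\<in>I - {y}. M i (transpose z y (q i))) = (\<Prod>i\<in>I - {y}. M i (q i))"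
        using q' by (intro prod.cong) auto
      then show ?thesis
        by (simp only: split[OF q] prod.remove[OF fin y] True) simp
    qed
    moreover have "?term z q = M z z * (M y y * (\<Prod>i\<in>I - {y}. M i (q i)))"
      by (simp only: split[OF q] prod.remove[OF fin y] True) (simp add: True)
    moreover have "(\<Prod>i\<in>I. ?N i (q i)) = (M y y + ?c) * (\<Prod>i\<in>I - {y}. M i (q i))"
    proof -
      have "(\<Prod>i\<in>I - {y}. ?N i (q i)) = (\<Prod>i\<in>I - {y}. M i (q i))"
        by (intro prod.cong) (auto simp: add_diagonal_def)
      then show ?thesis
        by (simp only: prod.remove[OF fin y] True) (simp add: add_diagonal_def)
    qed
    ultimately show ?thesis
      using nz by (simp add: field_simps)
  next
    case False
    \<comment> \<open>The preimage of \<open>y\<close> under \<open>q\<close> is sent to \<open>z\<close>, but only \<open>y\<close> is adjacent to \<open>z\<close>.\<close>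
    obtain i where i: "i \<in> I" "q i = y"
      using q y by (metis permutes_image imageE)
    then have "i \<noteq> y"
      using False by auto
    then have "M i (transpose z y (q i)) = 0"
      using leaf i by simp
    then have "(\<Prod>i\<in>I. M i (transpose z y (q i))) = 0"
      using i fin by (intro prod_zero) blast+
    moreover have "?N i (q i) = M i (q i)" for i
      using False by (auto simp: add_diagonal_def)
    ultimately show ?thesis
      by (simp only: split[OF q]) simp
  qed
  note pair = this
  have "permanent (insert z I) M = (\<Sum>b\<in>insert z I. \<Sum>q | q permutes I. ?term b q)"
    unfolding permanent_def by (rule sum_over_permutations_insert[OF fin z])
  also have "\<dots> = (\<Sum>b\<in>{z, y}. \<Sum>q | q permutes I. ?term b q)"
    using fin y other by (intro sum.mono_neutral_right) (auto intro!: sum.neutral)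
  also have "\<dots> = (\<Sum>q | q permutes I. ?term z q + ?term y q)"
  proof -
    have "z \<noteq> y"
      using y z by auto
    then show ?thesis
      by (simp add: sum.distrib)
  qed
  also have "\<dots> = M z z * permanent I ?N"
    unfolding permanent_def sum_distrib_left using pair by (intro sum.cong) auto
  finally show ?thesis .
qed

lemma add_diagonal_add_diagonal:
  "add_diagonal (add_diagonal M c) d = add_diagonal M (\<lambda>v. c v + d v)"
  by (auto simp: add_diagonal_def fun_eq_iff)

section \<open>Eliminating the pendant paths of a tree\<close>

definition path_indices :: "nat list \<Rightarrow> (nat \<times> nat) set" where
  "path_indices as = (SIGMA i:{..<length as}. {..<as ! i})"

lemma pverts_T:
  "pverts (T as) = Spine ` {..<length as} \<union> case_prod Inner ` path_indices as
     \<union> case_prod Outer ` path_indices as"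
  by (auto simp: T_def edge_graph_def path_indices_def image_iff)

lemma neighbours_Inner:
  "(i, j) \<in> path_indices as \<Longrightarrow> {w. (Inner i j, w) \<in> parcs (T as)} = {Spine i, Outer i j}"
  by (auto simp: T_def edge_graph_def path_indices_def)

lemma neighbours_Outer:
  "(i, j) \<in> path_indices as \<Longrightarrow> {w. (Outer i j, w) \<in> parcs (T as)} = {Inner i j}"
  by (auto simp: T_def edge_graph_def path_indices_def)

lemma laplacian_commute: "laplacian (T as) u v = laplacian (T as) v u"
  by (auto simp: laplacian_def degree_matrix_def adjacency_matrix_def T_def edge_graph_def)

lemma laplacian_neighbours:
  "laplacian G u v = (if u = v then real (card {w. (u, w) \<in> parcs G}) else 0)
     - (if v \<in> {w. (u, w) \<in> parcs G} then 1 else 0)"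
  by (simp add: laplacian_def degree_matrix_def adjacency_matrix_def degree_eq_card_neighbours)

lemma laplacian_Inner:
  assumes "(i, j) \<in> path_indices as"
  shows "laplacian (T as) (Inner i j) v
    = (if v = Inner i j then 2 else if v = Spine i \<or> v = Outer i j then -1 else 0)"
  by (auto simp: laplacian_neighbours neighbours_Inner[OF assms])

lemma laplacian_Outer:
  assumes "(i, j) \<in> path_indices as"
  shows "laplacian (T as) (Outer i j) v
    = (if v = Outer i j then 1 else if v = Inner i j then -1 else 0)"
  by (auto simp: laplacian_neighbours neighbours_Outer[OF assms])

text \<open>
  Eliminating a path changes the diagonal of the matrix that the remaining paths meet, so the
  induction over the set \<open>K\<close> of paths needs an arbitrary correction \<open>c\<close>; requiring it to vanish on
  the paths still present keeps their diagonal entries at \<open>2\<close> and \<open>1\<close>.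
\<close>

lemma permanent_eliminate_paths:
  assumes "finite K" "K \<subseteq> path_indices as"
    and "\<And>i j. (i, j) \<in> K \<Longrightarrow> c (Inner i j) = 0 \<and> c (Outer i j) = 0"
  shows "permanent (Spine ` {..<length as} \<union> case_prod Inner ` K \<union> case_prod Outer ` K)
      (add_diagonal (laplacian (T as)) c)
    = 3 ^ card K * permanent (Spine ` {..<length as})
      (add_diagonal (laplacian (T as)) (\<lambda>v. c v + card {l \<in> K. Spine (fst l) = v} / 3))"
  using assms
proof (induction K arbitrary: c)
  case empty
  then show ?case by simp
next
  case (insert k K)
  let ?L = "laplacian (T as)"
  obtain i j where k: "k = (i, j)" by fastforce
  define J where "J = Spine ` {..<length as} \<union> case_prod Inner ` K \<union> case_prod Outer ` K"
  \<comment> \<open>The corrections after eliminating the outer vertex, and then the inner vertex, of path \<open>k\<close>.\<close>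
  define c' where "c' = (\<lambda>v. c v + ((\<lambda>_. 0)(Inner i j := 1)) v)"
  define c'' where "c'' = (\<lambda>v. c' v + ((\<lambda>_. 0)(Spine i := 1 / 3)) v)"
  have ij: "(i, j) \<in> path_indices as" and c0: "c (Inner i j) = 0" "c (Outer i j) = 0"
    using insert.prems k by auto
  have J: "finite J" "Inner i j \<notin> J" "Outer i j \<notin> J" "Spine i \<in> J"
    using insert.hyps ij k by (auto simp: J_def path_indices_def)
  note rows = laplacian_Inner[OF ij] laplacian_Outer[OF ij]
  note simps = add_diagonal_def c0 rows rows[THEN trans[OF laplacian_commute]]
  have "permanent (insert (Outer i j) (insert (Inner i j) J)) (add_diagonal ?L c)
      = permanent (insert (Inner i j) J) (add_diagonal ?L c')"
  proof -
    let ?M = "add_diagonal ?L c"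
    have leaf: "?M (Outer i j) v = 0 \<and> ?M v (Outer i j) = 0"
      if "v \<in> insert (Inner i j) J" "v \<noteq> Inner i j" for v
      using that J by (auto simp: simps)
    have "?M (Outer i j) (Outer i j) = 1" "?M (Outer i j) (Inner i j) = -1"
      "?M (Inner i j) (Outer i j) = -1"
      by (simp_all add: simps)
    then show ?thesis
      using permanent_insert_leaf[where M = ?M and z = "Outer i j" and I = "insert (Inner i j) J"
          and y = "Inner i j"] J leaf
      by (simp add: add_diagonal_add_diagonal c'_def)
  qed
  also have "\<dots> = 3 * permanent J (add_diagonal ?L c'')"
  proof -
    let ?M = "add_diagonal ?L c'"
    have leaf: "?M (Inner i j) v = 0 \<and> ?M v (Inner i j) = 0" if "v \<in> J" "v \<noteq> Spine i" for v
      using that J by (auto simp: simps)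
    have "?M (Inner i j) (Inner i j) = 3" "?M (Inner i j) (Spine i) = -1"
      "?M (Spine i) (Inner i j) = -1"
      by (simp_all add: simps c'_def)
    then show ?thesis
      using permanent_insert_leaf[where M = ?M and z = "Inner i j" and I = J and y = "Spine i"]
        J leaf
      by (simp add: add_diagonal_add_diagonal c''_def)
  qed
  also have "permanent J (add_diagonal ?L c'')
      = 3 ^ card K * permanent (Spine ` {..<length as})
          (add_diagonal ?L (\<lambda>v. c'' v + card {l \<in> K. Spine (fst l) = v} / 3))"
    unfolding J_def using insert.prems insert.hyps k
    by (intro insert.IH) (auto simp: c'_def c''_def)
  also have "permanent (Spine ` {..<length as})
          (add_diagonal ?L (\<lambda>v. c'' v + card {l \<in> K. Spine (fst l) = v} / 3))
      = permanent (Spine ` {..<length as})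
          (add_diagonal ?L (\<lambda>v. c v + card {l \<in> insert k K. Spine (fst l) = v} / 3))"
  \<comment> \<open>The correction left behind at \<open>Inner i j\<close> is harmless: that index has been eliminated.\<close>
  proof (rule permanent_cong)
    fix u v assume u: "u \<in> Spine ` {..<length as}"
    have "{l \<in> insert k K. Spine (fst l) = u}
        = (if u = Spine i then insert k {l \<in> K. Spine (fst l) = u} else {l \<in> K. Spine (fst l) = u})"
      using k by auto
    then have "card {l \<in> insert k K. Spine (fst l) = u}
        = card {l \<in> K. Spine (fst l) = u} + (if u = Spine i then 1 else 0)"
      using insert.hyps by simp
    moreover have "c'' u = c u + (if u = Spine i then 1 / 3 else 0)"
      using u by (auto simp: c'_def c''_def)
    ultimately have "c'' u + card {l \<in> K. Spine (fst l) = u} / 3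
        = c u + card {l \<in> insert k K. Spine (fst l) = u} / 3"
      by (simp only: of_nat_add add_divide_distrib) simp
    then show "add_diagonal ?L (\<lambda>v. c'' v + card {l \<in> K. Spine (fst l) = v} / 3) u v
        = add_diagonal ?L (\<lambda>v. c v + card {l \<in> insert k K. Spine (fst l) = v} / 3) u v"
      unfolding add_diagonal_def by (cases "u = v") (simp_all only: if_True if_False)
  qed
  finally show ?case
    using insert.hyps by (simp add: J_def k mult.assoc)
qed

lemma inj_on_case_prod_path:
  "inj_on (case_prod Inner) K" "inj_on (case_prod Outer) K"
  by (auto simp: inj_on_def)

lemma permanent_laplacian_T:
  "permanent (pverts (T as)) (laplacian (T as))
    = 3 ^ sum_list as * permanent (Spine ` {..<length as})
      (add_diagonal (laplacian (T as)) (\<lambda>v. case v of Spine i \<Rightarrow> real (as ! i) / 3 | _ \<Rightarrow> 0))"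
proof -
  have fin: "finite (path_indices as)"
    by (simp add: path_indices_def)
  have card: "card (path_indices as) = sum_list as"
    by (simp add: path_indices_def sum_list_sum_nth atLeast0LessThan)
  have feet: "card {k \<in> path_indices as. fst k = i} = as ! i"
    if "i < length as" for i
  proof -
    have "{k \<in> path_indices as. fst k = i} = Pair i ` {..<as ! i}"
      using that by (auto simp: path_indices_def)
    then show ?thesis
      by (simp add: card_image inj_on_def)
  qed
  have "add_diagonal (laplacian (T as)) (\<lambda>_. 0) = laplacian (T as)"
    by (simp add: add_diagonal_def fun_eq_iff)
  then have "permanent (pverts (T as)) (laplacian (T as))
      = 3 ^ sum_list as * permanent (Spine ` {..<length as}) (add_diagonal (laplacian (T as))
          (\<lambda>v. card {k \<in> path_indices as. Spine (fst k) = v} / 3))"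
    using permanent_eliminate_paths[OF fin order_refl, of "\<lambda>_. 0"] by (simp add: pverts_T card)
  also have "permanent (Spine ` {..<length as}) (add_diagonal (laplacian (T as))
          (\<lambda>v. card {k \<in> path_indices as. Spine (fst k) = v} / 3))
      = permanent (Spine ` {..<length as})
      (add_diagonal (laplacian (T as)) (\<lambda>v. case v of Spine i \<Rightarrow> real (as ! i) / 3 | _ \<Rightarrow> 0))"
    by (rule permanent_cong) (auto simp: add_diagonal_def feet)
  finally show ?thesis .
qed

section \<open>The Laplacian ratio of \<open>T(3,3,3)\<close>\<close>

lemma neighbours_Spine_T333:
  "{w. (Spine 0, w) \<in> parcs (T [3, 3, 3])} = {Spine 1, Inner 0 0, Inner 0 1, Inner 0 2}"
  "{w. (Spine 1, w) \<in> parcs (T [3, 3, 3])}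
     = {Spine 0, Spine 2, Inner 1 0, Inner 1 1, Inner 1 2}"
  "{w. (Spine 2, w) \<in> parcs (T [3, 3, 3])} = {Spine 1, Inner 2 0, Inner 2 1, Inner 2 2}"
  by (auto simp: T_def edge_graph_def less_Suc_eq numeral_eq_Suc)

lemma degree_T333:
  "degree (T [3, 3, 3]) (Spine 0) = 4"
  "degree (T [3, 3, 3]) (Spine 1) = 5"
  "degree (T [3, 3, 3]) (Spine 2) = 4"
  unfolding degree_eq_card_neighbours neighbours_Spine_T333 by simp_all

lemma degree_Inner: "(i, j) \<in> path_indices as \<Longrightarrow> degree (T as) (Inner i j) = 2"
  by (simp add: degree_eq_card_neighbours neighbours_Inner)

lemma degree_Outer: "(i, j) \<in> path_indices as \<Longrightarrow> degree (T as) (Outer i j) = 1"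
  by (simp add: degree_eq_card_neighbours neighbours_Outer)

lemma lessThan_3: "{..<3} = {0, 1, 2::nat}"
  by auto

text \<open>
  Leaf elimination continues along the spine: the diagonal \<open>5, 6, 5\<close> becomes \<open>5, 6 + 1 / 5\<close> and then
  \<open>5 + 5 / 31\<close>, and the extracted factors are \<open>5 * (31 / 5) * (160 / 31) = 160\<close>.
\<close>

lemma permanent_spine_T333:
  "permanent (Spine ` {..<3}) (add_diagonal (laplacian (T [3, 3, 3]))
     (\<lambda>v. case v of Spine i \<Rightarrow> real ([3, 3, 3] ! i) / 3 | _ \<Rightarrow> 0)) = 160"
proof -
  let ?M = "add_diagonal (laplacian (T [3, 3, 3]))
     (\<lambda>v. case v of Spine i \<Rightarrow> real ([3, 3, 3] ! i) / 3 | _ \<Rightarrow> 0)"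
  note lap = laplacian_neighbours[of "T [3, 3, 3]" "Spine 0"]
    laplacian_neighbours[of "T [3, 3, 3]" "Spine 1"]
    laplacian_neighbours[of "T [3, 3, 3]" "Spine 2"]
  have M: "?M (Spine 0) (Spine 0) = 5" "?M (Spine 1) (Spine 1) = 6" "?M (Spine 2) (Spine 2) = 5"
    "?M (Spine 0) (Spine 1) = -1" "?M (Spine 1) (Spine 0) = -1"
    "?M (Spine 1) (Spine 2) = -1" "?M (Spine 2) (Spine 1) = -1"
    "?M (Spine 0) (Spine 2) = 0" "?M (Spine 2) (Spine 0) = 0"
    by (simp_all only: add_diagonal_def lap neighbours_Spine_T333) simp_all
  define N where "N = add_diagonal ?M ((\<lambda>_. 0)(Spine 1 := 1 / 5))"
  have N: "N (Spine 0) (Spine 0) = 5" "N (Spine 1) (Spine 1) = 31 / 5"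
    "N (Spine 0) (Spine 1) = -1" "N (Spine 1) (Spine 0) = -1"
    unfolding N_def add_diagonal_def[of ?M] M by simp_all
  have "permanent (Spine ` {..<3}) ?M = permanent (insert (Spine 2) {Spine 1, Spine 0}) ?M"
    by (simp add: lessThan_3 insert_commute)
  also have "\<dots> = 5 * permanent {Spine 1, Spine 0} N"
    unfolding N_def by (subst permanent_insert_leaf[where y = "Spine 1"]) (auto simp: M simp del: One_nat_def)
  also have "permanent {Spine 1, Spine 0} N
      = 31 / 5 * permanent {Spine 0} (add_diagonal N ((\<lambda>_. 0)(Spine 0 := 5 / 31)))"
    by (subst permanent_insert_leaf[where y = "Spine 0"]) (auto simp: N simp del: One_nat_def)
  also have "permanent {Spine 0} (add_diagonal N ((\<lambda>_. 0)(Spine 0 := 5 / 31))) = 160 / 31"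
    by (simp add: permanent_singleton add_diagonal_def[of N] N)
  finally show ?thesis
    by simp
qed

lemma laplacian_ratio_T333: "laplacian_ratio (T [3, 3, 3]) = 2 * (3 / 2) ^ 9"
proof -
  let ?K = "path_indices [3, 3, 3]"
  have fin: "finite ?K" and cardK: "card ?K = 9"
    by (simp_all add: path_indices_def lessThan_3)
  have "(\<Prod>v\<in>pverts (T [3, 3, 3]). real (degree (T [3, 3, 3]) v))
      = (\<Prod>v\<in>Spine ` {..<3}. real (degree (T [3, 3, 3]) v))
        * (\<Prod>v\<in>case_prod Inner ` ?K. real (degree (T [3, 3, 3]) v))
        * (\<Prod>v\<in>case_prod Outer ` ?K. real (degree (T [3, 3, 3]) v))"
  proof -
    have "pverts (T [3, 3, 3]) = Spine ` {..<3} \<union> case_prod Inner ` ?K \<union> case_prod Outer ` ?K"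
      by (simp add: pverts_T eval_nat_numeral)
    moreover have "(Spine ` {..<3} \<union> case_prod Inner ` ?K) \<inter> case_prod Outer ` ?K = {}"
      "Spine ` {..<3} \<inter> case_prod Inner ` ?K = {}"
      by auto
    ultimately show ?thesis
      using fin by (simp add: prod.union_disjoint)
  qed
  also have "(\<Prod>v\<in>Spine ` {..<3}. real (degree (T [3, 3, 3]) v)) = 80"
    using degree_T333 by (simp add: lessThan_3)
  also have "(\<Prod>v\<in>case_prod Inner ` ?K. real (degree (T [3, 3, 3]) v)) = 2 ^ 9"
    using cardK by (subst prod.reindex[OF inj_on_case_prod_path(1)]) (simp add: degree_Inner split_beta)
  also have "(\<Prod>v\<in>case_prod Outer ` ?K. real (degree (T [3, 3, 3]) v)) = 1"
    by (subst prod.reindex[OF inj_on_case_prod_path(2)]) (simp add: degree_Outer split_beta)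
  finally have "(\<Prod>v\<in>pverts (T [3, 3, 3]). real (degree (T [3, 3, 3]) v)) = 80 * 2 ^ 9"
    by simp
  moreover have "permanent (pverts (T [3, 3, 3])) (laplacian (T [3, 3, 3])) = 3 ^ 9 * 160"
  proof -
    have "length [3, 3, 3 :: nat] = 3" "sum_list [3, 3, 3 :: nat] = 9"
      by simp_all
    then show ?thesis
      by (simp only: permanent_laplacian_T permanent_spine_T333)
  qed
  ultimately show ?thesis
    by (simp add: laplacian_ratio_def power_divide)
qed

lemma card_pverts_T: "card (pverts (T as)) = length as + 2 * sum_list as"
proof -
  have fin: "finite (path_indices as)" and card: "card (path_indices as) = sum_list as"
    by (simp_all add: path_indices_def sum_list_sum_nth atLeast0LessThan)
  have "card (pverts (T as)) = card (Spine ` {..<length as})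
      + card (case_prod Inner ` path_indices as) + card (case_prod Outer ` path_indices as)"
    unfolding pverts_T using fin by (subst card_Un_disjoint, auto)+
  then show ?thesis
    by (simp add: card card_image[OF inj_on_case_prod_path(1)] card_image[OF inj_on_case_prod_path(2)]
      card_image inj_on_def)
qed

section \<open>Comparison with the subdivided star\<close>

lemma digraph_iso_degree:
  assumes "wf_digraph (with_proj G)"
    and "digraph_iso (with_proj G) (with_proj H)" "v \<in> pverts H"
  shows "\<exists>u\<in>pverts G. degree G u = degree H v"
proof -
  obtain h where h: "pre_digraph.digraph_isomorphism (with_proj G) h"
    and H: "with_proj H = app_iso h (with_proj G)"
    using assms(2) by (auto simp: digraph_iso_def)
  have "pverts H = iso_verts h ` pverts G"
    using arg_cong[OF H, of verts] by simp
  then obtain u where "u \<in> pverts G" "v = iso_verts h u"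
    using assms(3) by blast
  then show ?thesis
    using wf_digraph.out_degree_app_iso_eq[OF assms(1) h, of u] by (auto simp: degree_def H)
qed

lemma degree_Center: "degree (subdivided_star n) Center = (n - 1) div 2"
proof -
  have "{w. (Center, w) \<in> parcs (subdivided_star n)} = Mid ` {..<(n - 1) div 2}"
    by (auto simp: subdivided_star_def edge_graph_def)
  then show ?thesis
    by (simp add: degree_eq_card_neighbours card_image inj_on_def)
qed

lemma degree_T333_le: "v \<in> pverts (T [3, 3, 3]) \<Longrightarrow> degree (T [3, 3, 3]) v \<le> 5"
  using degree_T333
  by (auto simp: pverts_T degree_Inner degree_Outer less_Suc_eq eval_nat_numeral)

lemma not_iso_T333: "\<not> digraph_iso (with_proj (T [3, 3, 3])) (with_proj (subdivided_star 21))"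
proof
  assume iso: "digraph_iso (with_proj (T [3, 3, 3])) (with_proj (subdivided_star 21))"
  interpret pair_graph "T [3, 3, 3]"
    by (rule pair_graph_T)
  have "Center \<in> pverts (subdivided_star 21)"
    by (simp add: subdivided_star_def edge_graph_def)
  then obtain u where "u \<in> pverts (T [3, 3, 3])"
    "degree (T [3, 3, 3]) u = degree (subdivided_star 21) Center"
    using digraph_iso_degree[OF wf_digraph_axioms iso] by blast
  then show False
    using degree_T333_le[of u] by (simp add: degree_Center)
qed

theorem mainTheorem2:
  shows "card (pverts (T [3, 3, 3])) = 21
    \<and> laplacian_ratio (T [3, 3, 3]) = 2 * (3 / 2) ^ ((21 - 3) div 2)
    \<and> 2 * (3 / 2 :: real) ^ ((21 - 3) div 2) = 2 * (3 / 2) ^ 9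
    \<and> \<not> digraph_iso (with_proj (T [3, 3, 3])) (with_proj (subdivided_star 21))"
  using laplacian_ratio_T333 not_iso_T333 by (simp add: card_pverts_T)

end
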